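(* Let $(\boldsymbol V,\boldsymbol E)$, $o$, $\theta$, $W$ be as in the context. Suppose that $(\boldsymbol V,\boldsymbol E)$ satisfies the large-scale regularity hypothesis stated in the context, with constants $d\ge2$, $R_0\ge1$, $\alpha_0\in[0,1/2)$, and that there exist $p,q\in(1,\infty]$ with $\frac1p+\frac1q<\frac2d$ such that $$\sup_{R\ge1}\|\theta\|_{p,B(R)}+\sup_{R\ge1}\|\theta^{-1}\|_{1,B(R)}+\sup_{R\ge1}\|\nu\|_{q,B(R)}<\infty .$$ Let $\mathcal M:=\sup_{R\ge1}\bigl(\|1\vee\theta\|_{p,B(R)}\cdot\|1\vee\nu\|_{q,B(R)}+\|1\vee\theta^{-1}\|_{1,B(R)}\bigr)$. (i) If $\inf_{y\in\boldsymbol V}\theta(y)>0$, then for every $m\ge2$ there exist $d'>d$, $C_2\in(0,\infty)$ and $\alpha,\beta,\gamma\in(0,1)$ with $\alpha+\beta+\gamma=1$ such that for every $f:\boldsymbol V\to\mathbb R$, $$\|f\|_{\ell^2(\boldsymbol V,\theta)}^2\;\le\;C_{\rm AN}\,\mathcal M\,\mathcal E(f)^{\alpha}\,\|f\|_{\ell^1(\boldsymbol V,\theta)}^{2\beta}\,\|\eta^{m/2}f\|_{\ell^2(\boldsymbol V,\theta)}^{2\gamma},\qquad(\ast)$$ where $C_{\rm AN}:=C_2R_1^m$ and $R_1$ is the constant from part (ii) of the large-scale regularity hypothesis associated with $d'$. (ii) If the large-scale regularity hypothesis holds with $R_0=R_1=1$ and $\alpha_0=0$ (that is, the volume bounds and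 the Sobolev-type inequality in it hold for all $R\ge1$, $x\in B(R)$ and $1\le r\le R$), then, without assuming $\inf_{\boldsymbol V}\theta>0$, for every $m\ge2$ there exist $C_2\in(0,\infty)$ and $\alpha,\beta,\gamma\in(0,1)$ with $\alpha+\beta+\gamma=1$ such that $(\ast)$ holds for every $f:\boldsymbol V\to\mathbb R$ with $C_{\rm AN}=C_2$ (i.e. with $R_1=1$).
   Context: $(\boldsymbol V,\boldsymbol E)$ is an infinite, connected, locally finite graph with non-oriented edges; $x\sim y$ means $\{x,y\}\in\boldsymbol E$; $\mathrm{dist}(x,y)$ is the graph distance. Fix $o\in\boldsymbol V$ and put $\eta(y):=\max\{\mathrm{dist}(o,y),1\}$. $B(x,R):=\{y:\mathrm{dist}(x,y)\le\lfloor R\rfloor\}$ and $B(R):=B(o,R)$. Norms: for finite $A\subset\boldsymbol V$ and $1\le p<\infty$, $\|f\|_{p,A}:=\bigl(\frac1{|A|}\sum_{y\in A}|f(y)|^p\bigr)^{1/p}$ (normalized), $\|f\|_{\infty,A}:=\max_{A}|f|$; $\|f\|_{\ell^p(A)}:=(\sum_{y\in A}|f(y)|^p)^{1/p}$ (not normalized); $\|f\|_{\ell^p(\boldsymbol V,\theta)}:=(\sum_{y\in\boldsymbol V}|f(y)|^p\theta(y))^{1/p}$. $\theta:\boldsymbol V\to(0,\infty)$ is a positive reference measure. $W:\boldsymbol V\times\boldsymbol V\to[0,\infty)$ satisfies $W(x,y)=W(y,x)$, $W(x,y)>0$ whenever $x\sim y$, and $\mu(x):=\sum_{y\in \boldsymbol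 V}W(x,y)<\infty$ for all $x$. Set $\nu(x):=\sum_{y\sim x}W(x,y)^{-1}$ and $\mathcal E(f):=\frac12\sum_{x,y\in\boldsymbol V}W(x,y)(f(y)-f(x))^2\in[0,\infty]$. In products on the right-hand side of the inequality, $0\cdot\infty$ is read as $\infty$. Large-scale regularity hypothesis: there are constants $d\ge2$, $R_0\ge1$, $\alpha_0\in[0,1/2)$ such that (i) there are $c_{\rm reg},C_{\rm reg}\in(0,\infty)$ such that for all $R\ge R_0$, $R^{\alpha_0}\le r\le R$ and $x\in B(R)$: $c_{\rm reg}r^d\le|B(x,r)|\le C_{\rm reg}r^d$; (ii) for every $d'>d$ there is $R_1\ge R_0$ such that for every $1<\rho<d'$ and $\rho_*>\rho$ with $\frac{d'}{\rho_*}=\frac{d'}{\rho}-1$ there are $C_0,C_{\rm S}\in(0,\infty)$ and $\delta_{\rm S}\in[1,\infty)$ such that for all $R\ge R_1$, $x\in B(R)$, $C_0R^{\alpha_0}\le r\le R$ and all $f:\boldsymbol V\to\mathbb R$, $$\|f-(f)_{B(x,r)}\|_{\ell^{\rho_*}(B(x,r))}\le C_{\rm S}\,r^{1-d/d'}\Bigl(\sum_{y,z\in B(x,\delta_{\rm S}r),\,y\sim z}|f(y)-f(z)|^\rho\Bigr)^{1/\rho},$$ where $(f)_{B}:=\frac1{|B|}\sum_{y\in B}f(y)$. *)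

theory Defs
  imports "HOL-Analysis.Analysis"
begin

section \<open>Graphs\<close>

text \<open>The vertex set is the whole type \<^typ>\<open>'v\<close> and the edge set is a set of unordered pairs.\<close>

definition adj :: "'v set set \<Rightarrow> 'v \<Rightarrow> 'v \<Rightarrow> bool" where
  "adj E x y \<longleftrightarrow> {x, y} \<in> E"

definition infinite_connected_lf_graph :: "'v set set \<Rightarrow> bool" where
  "infinite_connected_lf_graph E \<longleftrightarrow>
     (\<forall>e\<in>E. \<exists>x y. e = {x, y}) \<and>
     infinite (UNIV :: 'v set) \<and>
     (\<forall>x y. (adj E)\<^sup>*\<^sup>* x y) \<and>
     (\<forall>x. finite {y. adj E x y})"

definition gdist :: "'v set set \<Rightarrow> 'v \<Rightarrow> 'v \<Rightarrow> nat" where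
  "gdist E x y = (LEAST n. (adj E ^^ n) x y)"

definition gball :: "'v set set \<Rightarrow> 'v \<Rightarrow> real \<Rightarrow> 'v set" where
  "gball E x R = {y. int (gdist E x y) \<le> \<lfloor>R\<rfloor>}"

definition eta :: "'v set set \<Rightarrow> 'v \<Rightarrow> 'v \<Rightarrow> real" where
  "eta E orig y = max (real (gdist E orig y)) 1"

section \<open>Norms\<close>

text \<open>Powers \<open>x\<^sup>a\<close> of extended nonnegative reals, for exponents \<open>a > 0\<close>.\<close>

definition epowr :: "ennreal \<Rightarrow> real \<Rightarrow> ennreal"  (infixr "epowr" 80) where
  "x epowr a = (if x = \<infinity> then \<infinity> else ennreal (enn2real x powr a))"

text \<open>Multiplication on \<open>[0,\<infinity>]\<close> with \<open>0 \<cdot> \<infinity> = \<infinity>\<close>, unlike the library's \<open>0 \<cdot> \<infinity> = 0\<close>.\<close>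

definition times_top :: "ennreal \<Rightarrow> ennreal \<Rightarrow> ennreal"  (infixl "\<odot>" 70) where
  "x \<odot> y = (if x = \<infinity> \<or> y = \<infinity> then \<infinity> else x * y)"

text \<open>The normalized norm over a finite nonempty set, with \<open>p \<in> [1,\<infinity>]\<close>.\<close>

definition norm_avg :: "ennreal \<Rightarrow> 'v set \<Rightarrow> ('v \<Rightarrow> real) \<Rightarrow> real" where
  "norm_avg p A f =
     (if p = \<infinity> then Max ((\<lambda>y. \<bar>f y\<bar>) ` A)
      else ((\<Sum>y\<in>A. \<bar>f y\<bar> powr enn2real p) / real (card A)) powr (1 / enn2real p))"

definition norm_ell :: "real \<Rightarrow> 'v set \<Rightarrow> ('v \<Rightarrow> real) \<Rightarrow> real" where
  "norm_ell p A f = (\<Sum>y\<in>A. \<bar>f y\<bar> powr p) powr (1 / p)"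

definition norm_weighted :: "real \<Rightarrow> ('v \<Rightarrow> real) \<Rightarrow> ('v \<Rightarrow> real) \<Rightarrow> ennreal" where
  "norm_weighted p \<theta> f = (\<Sum>\<^sub>\<infinity>y. ennreal (\<bar>f y\<bar> powr p * \<theta> y)) epowr (1 / p)"

section \<open>Conductances\<close>

definition nu :: "'v set set \<Rightarrow> ('v \<Rightarrow> 'v \<Rightarrow> real) \<Rightarrow> 'v \<Rightarrow> real" where
  "nu E W x = (\<Sum>y | adj E x y. inverse (W x y))"

definition energy :: "('v \<Rightarrow> 'v \<Rightarrow> real) \<Rightarrow> ('v \<Rightarrow> real) \<Rightarrow> ennreal" where
  "energy W f = (1 / 2) * (\<Sum>\<^sub>\<infinity>(x, y). ennreal (W x y * (f y - f x)\<^sup>2))"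

section \<open>Large-scale regularity\<close>

definition volume_regular :: "'v set set \<Rightarrow> 'v \<Rightarrow> real \<Rightarrow> real \<Rightarrow> real \<Rightarrow> bool" where
  "volume_regular E orig d R0 \<alpha>0 \<longleftrightarrow>
     (\<exists>creg > 0. \<exists>Creg > 0. \<forall>R \<ge> R0. \<forall>r. R powr \<alpha>0 \<le> r \<and> r \<le> R \<longrightarrow>
        (\<forall>x \<in> gball E orig R.
           creg * r powr d \<le> real (card (gball E x r)) \<and>
           real (card (gball E x r)) \<le> Creg * r powr d))"

definition avg :: "'v set \<Rightarrow> ('v \<Rightarrow> real) \<Rightarrow> real" where
  "avg A f = (\<Sum>y\<in>A. f y) / real (card A)"

definition sobolev_ineq ::
    "'v set set \<Rightarrow> 'v \<Rightarrow> real \<Rightarrow> real \<Rightarrow> real \<Rightarrow> real \<Rightarrow> real \<Rightarrow> real \<Rightarrow> real \<Rightarrow> real \<Rightarrow> real \<Rightarrow> bool" where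
  "sobolev_ineq E orig d d' \<rho> \<rho>s \<alpha>0 R1 C0 CS \<delta>S \<longleftrightarrow>
     (\<forall>R \<ge> R1. \<forall>x \<in> gball E orig R. \<forall>r. C0 * R powr \<alpha>0 \<le> r \<and> r \<le> R \<longrightarrow>
        (\<forall>f :: 'v \<Rightarrow> real.
           norm_ell \<rho>s (gball E x r) (\<lambda>y. f y - avg (gball E x r) f)
             \<le> CS * r powr (1 - d / d') *
               (\<Sum>(y, z) | y \<in> gball E x (\<delta>S * r) \<and> z \<in> gball E x (\<delta>S * r) \<and> adj E y z.
                  \<bar>f y - f z\<bar> powr \<rho>) powr (1 / \<rho>)))"

text \<open>
  The constant \<open>R\<^sub>1\<close> of the Sobolev part depends on \<open>d'\<close>. Since the anchored Nash inequality
  refers to it, it is a parameter \<open>R1 :: real \<Rightarrow> real\<close> here, not an existentially bound number.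
\<close>

definition large_scale_regular ::
    "'v set set \<Rightarrow> 'v \<Rightarrow> real \<Rightarrow> real \<Rightarrow> real \<Rightarrow> (real \<Rightarrow> real) \<Rightarrow> bool" where
  "large_scale_regular E orig d R0 \<alpha>0 R1 \<longleftrightarrow>
     volume_regular E orig d R0 \<alpha>0 \<and>
     (\<forall>d' > d. R1 d' \<ge> R0 \<and>
        (\<forall>\<rho> \<rho>s. 1 < \<rho> \<and> \<rho> < d' \<and> \<rho> < \<rho>s \<and> d' / \<rho>s = d' / \<rho> - 1 \<longrightarrow>
           (\<exists>C0 > 0. \<exists>CS > 0. \<exists>\<delta>S \<ge> 1. sobolev_ineq E orig d d' \<rho> \<rho>s \<alpha>0 (R1 d') C0 CS \<delta>S)))"

text \<open>
  Regularity at all scales: \<open>R\<^sub>0 = R\<^sub>1 = 1\<close> and \<open>\<alpha>\<^sub>0 = 0\<close>, with both bounds required for all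
  \<open>1 \<le> r \<le> R\<close>; in the Sobolev part this means \<open>C\<^sub>0 = 1\<close>.
\<close>

definition all_scale_regular :: "'v set set \<Rightarrow> 'v \<Rightarrow> real \<Rightarrow> bool" where
  "all_scale_regular E orig d \<longleftrightarrow>
     volume_regular E orig d 1 0 \<and>
     (\<forall>d' > d. \<forall>\<rho> \<rho>s. 1 < \<rho> \<and> \<rho> < d' \<and> \<rho> < \<rho>s \<and> d' / \<rho>s = d' / \<rho> - 1 \<longrightarrow>
        (\<exists>CS > 0. \<exists>\<delta>S \<ge> 1. sobolev_ineq E orig d d' \<rho> \<rho>s 0 1 1 CS \<delta>S))"

section \<open>The anchored Nash inequality\<close>

definition moment_const ::
    "'v set set \<Rightarrow> 'v \<Rightarrow> ('v \<Rightarrow> real) \<Rightarrow> ('v \<Rightarrow> 'v \<Rightarrow> real) \<Rightarrow> ennreal \<Rightarrow> ennreal \<Rightarrow> ennreal" where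
  "moment_const E orig \<theta> W p q =
     (SUP R\<in>{1::real..}. ennreal
        (norm_avg p (gball E orig R) (\<lambda>y. max 1 (\<theta> y)) *
           norm_avg q (gball E orig R) (\<lambda>y. max 1 (nu E W y)) +
         norm_avg 1 (gball E orig R) (\<lambda>y. max 1 (inverse (\<theta> y)))))"

definition anchored_nash ::
    "'v set set \<Rightarrow> 'v \<Rightarrow> ('v \<Rightarrow> real) \<Rightarrow> ('v \<Rightarrow> 'v \<Rightarrow> real) \<Rightarrow> ennreal \<Rightarrow> ennreal \<Rightarrow>
     real \<Rightarrow> real \<Rightarrow> real \<Rightarrow> real \<Rightarrow> real \<Rightarrow> ('v \<Rightarrow> real) \<Rightarrow> bool" where
  "anchored_nash E orig \<theta> W p q m C \<alpha> \<beta> \<gamma> f \<longleftrightarrow>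
     (norm_weighted 2 \<theta> f)\<^sup>2
       \<le> ennreal C \<odot> moment_const E orig \<theta> W p q \<odot> (energy W f epowr \<alpha>)
          \<odot> (norm_weighted 1 \<theta> f epowr (2 * \<beta>))
          \<odot> (norm_weighted 2 \<theta> (\<lambda>y. eta E orig y powr (m / 2) * f y) epowr (2 * \<gamma>))"

end

theory Submission
  imports Defs
begin

text \<open>
  The constant may depend on everything but \<open>f\<close>, so only the volume growth and \<open>L\<^sup>1\<close> averages of
  the moments matter, and a maximum-versus-path argument replaces the Sobolev inequality.
  Let \<open>s = \<parallel>f\<parallel>\<^sub>2\<^sup>2\<close>, \<open>a = \<parallel>f\<parallel>\<^sub>1\<close>, \<open>h = \<parallel>\<eta>\<^sup>m\<^sup>/\<^sup>2 f\<parallel>\<^sub>2\<^sup>2\<close> and choose \<open>R\<close> proportional to \<open>(h / s)\<close> to the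
  power \<open>1 / m\<close>, so that \<open>B(R)\<close> carries half of \<open>s\<close>. With \<open>M\<close> the maximum of \<open>\<bar>f\<bar>\<close> on \<open>B(R)\<close> one has
  \<open>s \<le> 2 M a\<close>. Since \<open>\<theta>(B(L R)) > 8 \<theta>(B(R))\<close> for a suitable constant \<open>L\<close>, the function \<open>\<bar>f\<bar>\<close> drops
  below \<open>M / 2\<close> somewhere in \<open>B(L R)\<close>, and following a path of length at most \<open>2 L R\<close> to that point gives
  \<open>M\<^sup>2 \<lesssim> R\<^sup>2 \<E>(f) \<Sum>\<nu> \<lesssim> R\<^sup>d\<^sup>+\<^sup>2 \<E>(f)\<close>, the sum being over \<open>B(L R)\<close>. Hence
  \<open>s\<^sup>2\<^sup>+\<^sup>k \<lesssim> \<E>(f) a\<^sup>2 h\<^sup>k\<close> with \<open>k = (d + 2) / m\<close>.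
\<close>

section \<open>Infinite sums in [0,\<infinity>] as suprema of finite sums\<close>

lemma infsum_ennreal_SUP:
  fixes g :: "'a \<Rightarrow> ennreal"
  shows "infsum g UNIV = (SUP F\<in>{F. finite F}. sum g F)"
  by (simp add: nonneg_infsum_complete)

text \<open>The real-valued core of the argument works with finite sums only. A finite value of an
  infinite sum enters it as a bound on all finite subsums, extracted here;
  \<open>infsum_ennreal_le\<close> goes back.\<close>

lemma sum_le_of_infsum_ennreal:
  fixes g :: "'a \<Rightarrow> real"
  assumes "\<And>x. 0 \<le> g x" "(\<Sum>\<^sub>\<infinity>x. ennreal (g x)) \<le> ennreal c" "0 \<le> c" "finite F"
  shows "sum g F \<le> c"
proof -
  have "ennreal (sum g F) = (\<Sum>x\<in>F. ennreal (g x))"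
    using assms(1) by simp
  also have "\<dots> \<le> (\<Sum>\<^sub>\<infinity>x. ennreal (g x))"
    unfolding infsum_ennreal_SUP using assms(4) by (intro SUP_upper) simp
  also note assms(2)
  finally show ?thesis
    using assms(3) by simp
qed

lemma infsum_ennreal_le:
  fixes g :: "'a \<Rightarrow> real"
  assumes "\<And>x. 0 \<le> g x" "\<And>F. finite F \<Longrightarrow> sum g F \<le> c"
  shows "(\<Sum>\<^sub>\<infinity>x. ennreal (g x)) \<le> ennreal c"
  unfolding infsum_ennreal_SUP
  using assms by (intro SUP_least) (simp add: ennreal_leI)

lemma epowr_ennreal: "0 \<le> c \<Longrightarrow> ennreal c epowr a = ennreal (c powr a)"
  by (simp add: epowr_def)

section \<open>Graph distance and finiteness of balls\<close>

lemma finite_neighbours: "infinite_connected_lf_graph E \<Longrightarrow> finite {y. adj E x y}"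
  unfolding infinite_connected_lf_graph_def by blast

text \<open>\<open>gdist\<close> is a \<open>LEAST\<close>, so its value says something only if some
  walk exists; connectedness supplies one.\<close>

lemma relpowp_gdist:
  assumes "infinite_connected_lf_graph E"
  shows "(adj E ^^ gdist E x y) x y"
proof -
  have "(adj E)\<^sup>*\<^sup>* x y"
    using assms unfolding infinite_connected_lf_graph_def by blast
  then show ?thesis
    unfolding gdist_def by (metis LeastI rtranclp_imp_relpowp)
qed

lemma gdist_le: "(adj E ^^ n) x y \<Longrightarrow> gdist E x y \<le> n"
  unfolding gdist_def by (rule Least_le)

lemma gdist_self: "gdist E x x = 0"
  using gdist_le[of 0 E x x] by simp

lemma mem_gball: "y \<in> gball E x R \<longleftrightarrow> real (gdist E x y) \<le> R"
  by (auto simp: gball_def le_floor_iff)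

lemma center_in_gball: "0 \<le> R \<Longrightarrow> x \<in> gball E x R"
  by (simp add: mem_gball gdist_self)

text \<open>The set collects the endpoints of all walks of length n, not only the points at distance
  n. It is therefore a union of neighbourhoods of the previous set, and local finiteness carries the
  induction.\<close>

lemma finite_sphere:
  assumes g: "infinite_connected_lf_graph E"
  shows "finite {y. (adj E ^^ n) x y}"
proof (induction n)
  case 0
  have "{y. (adj E ^^ 0) x y} = {x}"
    by auto
  then show ?case
    by (simp only: finite.intros)
next
  case (Suc n)
  have eq: "{y. (adj E ^^ Suc n) x y} = (\<Union>u\<in>{u. (adj E ^^ n) x u}. {y. adj E u y})"
    by (simp add: relcompp_apply set_eq_iff)
  show ?case
    unfolding eq by (rule finite_UN_I[OF Suc.IH finite_neighbours[OF g]])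
qed

lemma finite_gball:
  assumes g: "infinite_connected_lf_graph E"
  shows "finite (gball E x R)"
proof (rule finite_subset)
  show "gball E x R \<subseteq> (\<Union>n\<in>{..nat \<lfloor>R\<rfloor>}. {y. (adj E ^^ n) x y})"
  proof
    fix y assume "y \<in> gball E x R"
    then have "gdist E x y \<le> nat \<lfloor>R\<rfloor>"
      by (intro le_nat_floor) (simp add: mem_gball)
    then show "y \<in> (\<Union>n\<in>{..nat \<lfloor>R\<rfloor>}. {y. (adj E ^^ n) x y})"
      using relpowp_gdist[OF g, of x y] by (intro UN_I[of "gdist E x y"]) simp_all
  qed
  show "finite (\<Union>n\<in>{..nat \<lfloor>R\<rfloor>}. {y. (adj E ^^ n) x y})"
    by (rule finite_UN_I[OF finite_atMost finite_sphere[OF g]])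
qed

lemma card_gball_pos:
  assumes "infinite_connected_lf_graph E" "0 \<le> R"
  shows "0 < card (gball E x R)"
proof -
  have "gball E x R \<noteq> {}"
    using center_in_gball[OF assms(2)] by fastforce
  then show ?thesis
    by (simp add: card_gt_0_iff finite_gball[OF assms(1)])
qed

text \<open>Telescoping along a walk. Each step starts at a vertex reached from x in fewer than n
  steps, hence within distance R by \<open>gdist_le\<close>, so the bound D is available for
  it.\<close>

lemma increment_le_dist:
  fixes f :: "'v \<Rightarrow> real"
  assumes "\<And>u v. adj E u v \<Longrightarrow> real (gdist E x u) \<le> R \<Longrightarrow> \<bar>f v - f u\<bar> \<le> D"
    and "(adj E ^^ n) x z" "real n \<le> R"
  shows "\<bar>f z - f x\<bar> \<le> real n * D"
  using assms(2,3)
proof (induction n arbitrary: z)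
  case (Suc n)
  from Suc.prems(1) obtain u where u: "(adj E ^^ n) x u" "adj E u z"
    by (rule relpowp_Suc_E)
  have "real (gdist E x u) \<le> R"
    using gdist_le[OF u(1)] Suc.prems(2) by simp
  then have "\<bar>f z - f u\<bar> \<le> D"
    using assms(1) u(2) by blast
  moreover have "\<bar>f u - f x\<bar> \<le> real n * D"
    using Suc.IH[OF u(1)] Suc.prems(2) by simp
  ultimately show ?case
    by (simp add: algebra_simps)
qed simp

section \<open>Averages, normalized norms and the moment constant\<close>

lemma convex_on_powr_nonneg:
  assumes p: "1 \<le> p"
  shows "convex_on {0..} (\<lambda>x::real. x powr p)"
proof (rule convex_onI)
  \<comment> \<open>Convexity on the open half-line is \<open>powr_convex\<close>. If one of the two
    points is 0, the inequality reduces to this one, which is t^p <= t on (0,1).\<close>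
  have small: "(t * z) powr p \<le> t * z powr p" if "0 < t" "t < 1" "0 \<le> z" for t z :: real
  proof -
    have "t powr p \<le> t powr 1"
      using that p by (intro powr_mono') auto
    then show ?thesis
      using that by (simp add: powr_mult mult_right_mono)
  qed
  fix t x y :: real
  assume t: "0 < t" "t < 1" and "x \<in> {0..}" "y \<in> {0..}"
  then consider "x = 0" "0 \<le> y" | "y = 0" "0 \<le> x" | "x \<in> {0<..}" "y \<in> {0<..}"
    by fastforce
  then show "((1 - t) *\<^sub>R x + t *\<^sub>R y) powr p \<le> (1 - t) * x powr p + t * y powr p"
  proof cases
    case 1
    then show ?thesis using small[OF t, of y] by simp
  next
    case 2
    then show ?thesis using small[of "1 - t" x] t by simp
  next
    case 3
    then show ?thesis using convex_onD[OF powr_convex[OF p], of t x y] t by simp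
  qed
qed simp

text \<open>Jensen's inequality with equal weights 1/|A| for the convex function x^p; for p =
  \<infinity> the mean is at most the maximum. It turns every moment hypothesis into an L1
  bound.\<close>

lemma mean_le_norm_avg:
  assumes A: "finite A" "A \<noteq> {}" and p: "1 \<le> p"
  shows "(\<Sum>y\<in>A. \<bar>f y\<bar>) \<le> norm_avg p A f * real (card A)"
proof (cases "p = \<infinity>")
  case True
  have "\<bar>f y\<bar> \<le> norm_avg p A f" if "y \<in> A" for y
    using that A True by (simp add: norm_avg_def)
  then show ?thesis
    using sum_bounded_above[of A "\<lambda>y. \<bar>f y\<bar>" "norm_avg p A f"] by (simp add: mult.commute)
next
  case False
  define s where "s = enn2real p"
  have s: "1 \<le> s"
    using p False enn2real_mono[of 1 p] by (simp add: s_def top.not_eq_extremum)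
  have n: "0 < real (card A)"
    using A by (simp add: card_gt_0_iff)
  have "(\<Sum>y\<in>A. (1 / real (card A)) *\<^sub>R \<bar>f y\<bar>) powr s
      \<le> (\<Sum>y\<in>A. (1 / real (card A)) * (\<bar>f y\<bar> powr s))"
    using A n convex_on_sum[OF A convex_on_powr_nonneg[OF s], of "\<lambda>_. 1 / real (card A)" "\<lambda>y. \<bar>f y\<bar>"]
    by simp
  then have "((\<Sum>y\<in>A. \<bar>f y\<bar>) / real (card A)) powr s \<le> (\<Sum>y\<in>A. \<bar>f y\<bar> powr s) / real (card A)"
    by (simp flip: sum_divide_distrib)
  then have "(((\<Sum>y\<in>A. \<bar>f y\<bar>) / real (card A)) powr s) powr (1 / s)
      \<le> ((\<Sum>y\<in>A. \<bar>f y\<bar> powr s) / real (card A)) powr (1 / s)"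
    using s by (intro powr_mono2) auto
  moreover have "0 \<le> (\<Sum>y\<in>A. \<bar>f y\<bar>) / real (card A)"
    by (simp add: sum_nonneg)
  ultimately have "(\<Sum>y\<in>A. \<bar>f y\<bar>) / real (card A) \<le> norm_avg p A f"
    using s False by (simp add: norm_avg_def powr_powr flip: s_def)
  then show ?thesis
    using n by (simp add: field_simps)
qed

lemma norm_avg_nonneg: "finite A \<Longrightarrow> A \<noteq> {} \<Longrightarrow> 0 \<le> norm_avg p A f"
  by (auto simp: norm_avg_def Max_ge_iff)

text \<open>Cauchy-Schwarz for the square roots of \<theta> and 1/\<theta>. It converts the bound on
  the averages of 1/\<theta> into a lower bound on the measure of balls.\<close>

lemma card_sq_le_sum_times_sum_inverse:
  fixes \<theta> :: "'v \<Rightarrow> real"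
  assumes "\<And>y. 0 < \<theta> y"
  shows "(real (card A))\<^sup>2 \<le> (\<Sum>y\<in>A. \<theta> y) * (\<Sum>y\<in>A. inverse (\<theta> y))"
proof -
  have "\<theta> y \<ge> 0" for y
    using assms less_imp_le by blast
  moreover have "sqrt (\<theta> y) * sqrt (inverse (\<theta> y)) = 1" for y
    using assms[of y] by (simp flip: real_sqrt_mult)
  ultimately show ?thesis
    using Cauchy_Schwarz_ineq_sum[of "\<lambda>y. sqrt (\<theta> y)" "\<lambda>y. sqrt (inverse (\<theta> y))" A] by simp
qed

text \<open>Lets the moment constant be inserted as a factor on the right-hand side at no cost. At
  radius 1 its last summand is already the average of a function that is at least 1.\<close>

lemma moment_const_ge_1:
  assumes g: "infinite_connected_lf_graph E"
  shows "1 \<le> moment_const E orig \<theta> W p q"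
proof -
  let ?B = "gball E orig 1"
  have B: "finite ?B" "?B \<noteq> {}" "0 < real (card ?B)"
    using finite_gball[OF g] center_in_gball[of 1 orig E] card_gball_pos[OF g] by auto
  have "real (card ?B) = (\<Sum>y\<in>?B. 1)"
    by simp
  also have "\<dots> \<le> (\<Sum>y\<in>?B. \<bar>max 1 (inverse (\<theta> y))\<bar>)"
    by (intro sum_mono) auto
  also have "\<dots> \<le> norm_avg 1 ?B (\<lambda>y. max 1 (inverse (\<theta> y))) * real (card ?B)"
    by (rule mean_le_norm_avg) (use B in auto)
  finally have "1 \<le> norm_avg 1 ?B (\<lambda>y. max 1 (inverse (\<theta> y)))"
    using B(3) by simp
  moreover have "0 \<le> norm_avg p ?B (\<lambda>y. max 1 (\<theta> y)) * norm_avg q ?B (\<lambda>y. max 1 (nu E W y))"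
    by (intro mult_nonneg_nonneg norm_avg_nonneg B)
  ultimately have "ennreal 1 \<le> ennreal
        (norm_avg p ?B (\<lambda>y. max 1 (\<theta> y)) * norm_avg q ?B (\<lambda>y. max 1 (nu E W y)) +
         norm_avg 1 ?B (\<lambda>y. max 1 (inverse (\<theta> y))))"
    by (intro ennreal_leI) linarith
  also have "\<dots> \<le> moment_const E orig \<theta> W p q"
    unfolding moment_const_def by (rule SUP_upper2[of 1]) auto
  finally show ?thesis
    by (simp only: ennreal_1)
qed

lemma sum_le_card_of_norm_avg_bounded:
  assumes g: "infinite_connected_lf_graph E" and p: "1 \<le> p"
    and fin: "(SUP R\<in>{1::real..}. ennreal (norm_avg p (gball E orig R) h)) < \<infinity>"
  shows "\<exists>K>0. \<forall>R\<ge>1. (\<Sum>y\<in>gball E orig R. h y) \<le> K * real (card (gball E orig R))"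
proof -
  obtain k where k: "(SUP R\<in>{1::real..}. ennreal (norm_avg p (gball E orig R) h)) = ennreal k" "0 \<le> k"
    using fin unfolding infinity_ennreal_def less_top_ennreal by blast
  \<comment> \<open>The shift by 1 keeps the constant positive even when the supremum k is
    0.\<close>
  have "(\<Sum>y\<in>gball E orig R. h y) \<le> (k + 1) * real (card (gball E orig R))" if R: "R \<ge> 1" for R
  proof -
    let ?B = "gball E orig R"
    have B: "finite ?B" "?B \<noteq> {}"
      using finite_gball[OF g] center_in_gball[of R orig E] R by auto
    have "ennreal (norm_avg p ?B h) \<le> ennreal k"
      unfolding k(1)[symmetric] using R by (intro SUP_upper2[of R]) auto
    then have "norm_avg p ?B h \<le> k + 1"
      using k(2) by simp
    have "(\<Sum>y\<in>?B. h y) \<le> (\<Sum>y\<in>?B. \<bar>h y\<bar>)"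
      by (intro sum_mono) simp
    also have "\<dots> \<le> norm_avg p ?B h * real (card ?B)"
      by (rule mean_le_norm_avg[OF B p])
    also have "\<dots> \<le> (k + 1) * real (card ?B)"
      by (intro mult_right_mono) (use \<open>norm_avg p ?B h \<le> k + 1\<close> in auto)
    finally show ?thesis .
  qed
  then show ?thesis
    using k(2) by (intro exI[of _ "k + 1"]) auto
qed

section \<open>Ingredients: the path estimate, growth of the measure, tails, edge increments\<close>

lemma sum_sq_le_increment:
  fixes f \<theta> :: "'v \<Rightarrow> real"
  assumes g: "infinite_connected_lf_graph E"
    and theta: "\<And>y. 0 < \<theta> y"
    and R: "1 \<le> R" and L: "1 \<le> L"
    and grow: "8 * (\<Sum>y\<in>gball E x R. \<theta> y) < (\<Sum>y\<in>gball E x (L * R). \<theta> y)"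
    and half: "s \<le> 2 * (\<Sum>y\<in>gball E x R. (f y)\<^sup>2 * \<theta> y)"
    and total: "(\<Sum>y\<in>gball E x (L * R). (f y)\<^sup>2 * \<theta> y) \<le> s"
    and l1: "(\<Sum>y\<in>gball E x R. \<bar>f y\<bar> * \<theta> y) \<le> a"
    and D: "\<And>u v. adj E u v \<Longrightarrow> real (gdist E x u) \<le> L * R \<Longrightarrow> \<bar>f v - f u\<bar> \<le> D"
    and D0: "0 \<le> D"
  shows "s \<le> 8 * (L * R) * D * a"
proof -
  let ?B = "gball E x R" and ?B' = "gball E x (L * R)"
  have fin: "finite ?B" "finite ?B'"
    by (simp_all add: finite_gball[OF g])
  have th0: "0 \<le> \<theta> y" for y
    using theta[of y] by simp
  have xB: "x \<in> ?B"
    using R by (simp add: center_in_gball)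
  have RL: "R \<le> L * R"
    using R L by simp
  define M where "M = Max ((\<lambda>y. \<bar>f y\<bar>) ` ?B)"
  have M: "\<bar>f y\<bar> \<le> M" if "y \<in> ?B" for y
    using that fin by (simp add: M_def)
  have "M \<in> (\<lambda>y. \<bar>f y\<bar>) ` ?B"
    unfolding M_def using fin xB by (intro Max_in) auto
  then obtain w where w: "w \<in> ?B" "\<bar>f w\<bar> = M"
    by auto
  have M0: "0 \<le> M"
    using w by auto
  have a0: "0 \<le> a"
    by (rule order_trans[OF _ l1]) (simp add: sum_nonneg th0)
  \<comment> \<open>On the small ball f^2 <= M |f|, which together with \<open>half\<close> gives s
    <= 2 M a. It then remains to show M <= 4 L R D.\<close>
  have "(\<Sum>y\<in>?B. (f y)\<^sup>2 * \<theta> y) \<le> (\<Sum>y\<in>?B. M * (\<bar>f y\<bar> * \<theta> y))"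
  proof (intro sum_mono)
    fix y assume "y \<in> ?B"
    then have "\<bar>f y\<bar> * (\<bar>f y\<bar> * \<theta> y) \<le> M * (\<bar>f y\<bar> * \<theta> y)"
      using M th0 by (intro mult_right_mono) auto
    then show "(f y)\<^sup>2 * \<theta> y \<le> M * (\<bar>f y\<bar> * \<theta> y)"
      by (simp add: power2_eq_square flip: mult.assoc abs_mult)
  qed
  also have "\<dots> \<le> M * a"
    unfolding sum_distrib_left[symmetric] using l1 M0 by (rule mult_left_mono)
  finally have sM: "s \<le> 2 * (M * a)"
    using half by simp
  have inc: "\<bar>f z - f x\<bar> \<le> (L * R) * D" if "z \<in> ?B'" for z
  proof -
    have z: "real (gdist E x z) \<le> L * R"
      using that by (simp add: mem_gball)
    have "\<bar>f z - f x\<bar> \<le> real (gdist E x z) * D"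
      by (rule increment_le_dist[OF D relpowp_gdist[OF g] z])
    also have "\<dots> \<le> (L * R) * D"
      using z D0 by (rule mult_right_mono)
    finally show ?thesis .
  qed
  have "M \<le> 4 * ((L * R) * D)"
  proof (cases "M = 0")
    case True
    then show ?thesis using R L D0 by simp
  next
    case False
    \<comment> \<open>Otherwise f^2 >= M^2/4 on the large ball, and M^2/4 \<theta>(B') <= s <= 2 M^2
      \<theta>(B), that is \<theta>(B') <= 8 \<theta>(B). This is the source of the factor 8 in
      \<open>grow\<close>.\<close>
    have "\<exists>z\<in>?B'. \<bar>f z\<bar> \<le> M / 2"
    proof (rule ccontr)
      assume "\<not> ?thesis"
      then have big: "M / 2 \<le> \<bar>f z\<bar>" if "z \<in> ?B'" for z
        using that by force
      have "M\<^sup>2 / 4 * (\<Sum>y\<in>?B'. \<theta> y) = (\<Sum>y\<in>?B'. (M / 2)\<^sup>2 * \<theta> y)"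
        by (simp add: sum_distrib_left power_divide)
      also have "\<dots> \<le> (\<Sum>y\<in>?B'. (f y)\<^sup>2 * \<theta> y)"
      proof (intro sum_mono mult_right_mono th0)
        fix y assume "y \<in> ?B'"
        then show "(M / 2)\<^sup>2 \<le> (f y)\<^sup>2"
          using big M0 by (simp add: abs_le_square_iff[symmetric])
      qed
      also have "\<dots> \<le> 2 * (\<Sum>y\<in>?B. (f y)\<^sup>2 * \<theta> y)"
        using total half by linarith
      also have "\<dots> \<le> 2 * (\<Sum>y\<in>?B. M\<^sup>2 * \<theta> y)"
      proof (intro mult_left_mono sum_mono mult_right_mono th0)
        fix y assume "y \<in> ?B"
        then show "(f y)\<^sup>2 \<le> M\<^sup>2"
          using M M0 by (simp add: abs_le_square_iff[symmetric])
      qed simp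
      also have "\<dots> = M\<^sup>2 / 4 * (8 * (\<Sum>y\<in>?B. \<theta> y))"
        by (simp add: sum_distrib_left ac_simps)
      finally have "M\<^sup>2 / 4 * (\<Sum>y\<in>?B'. \<theta> y) \<le> M\<^sup>2 / 4 * (8 * (\<Sum>y\<in>?B. \<theta> y))" .
      then have "(\<Sum>y\<in>?B'. \<theta> y) \<le> 8 * (\<Sum>y\<in>?B. \<theta> y)"
        using False by simp
      then show False using grow by simp
    qed
    then obtain z where z: "z \<in> ?B'" "\<bar>f z\<bar> \<le> M / 2"
      by blast
    \<comment> \<open>Both the maximizer w and the low point z are compared with the centre x, at
      cost L R D each, so M - M/2 <= 2 L R D.\<close>
    have "w \<in> ?B'"
      using w(1) RL by (simp add: mem_gball)
    from inc[OF this] inc[OF z(1)] z(2) w(2) show ?thesis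
      by linarith
  qed
  then have "2 * (M * a) \<le> 2 * (4 * ((L * R) * D) * a)"
    using a0 by (intro mult_left_mono mult_right_mono) auto
  then show ?thesis
    using sM by (simp add: algebra_simps)
qed


text \<open>The measure of B(R) is at most K C R^d, while Cauchy-Schwarz bounds that of B(L R) below
  by |B(L R)| / K', hence by c (L R)^d / K'. A large L makes the ratio exceed 8.\<close>

lemma weighted_volume_growth:
  fixes \<theta> :: "'v \<Rightarrow> real"
  assumes g: "infinite_connected_lf_graph E"
    and theta: "\<And>y. 0 < \<theta> y"
    and d: "0 < d" and R0: "1 \<le> R0" and c: "0 < c" and C: "0 < C" and K: "0 < K" "0 < K'"
    and vol: "\<And>R. R0 \<le> R \<Longrightarrow> c * R powr d \<le> real (card (gball E x R))"
      "\<And>R. R0 \<le> R \<Longrightarrow> real (card (gball E x R)) \<le> C * R powr d"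
    and mean: "\<And>R. 1 \<le> R \<Longrightarrow> (\<Sum>y\<in>gball E x R. \<theta> y) \<le> K * real (card (gball E x R))"
    and mean_inv:
      "\<And>R. 1 \<le> R \<Longrightarrow> (\<Sum>y\<in>gball E x R. inverse (\<theta> y)) \<le> K' * real (card (gball E x R))"
  shows "\<exists>L\<ge>1. \<forall>R\<ge>R0. 8 * (\<Sum>y\<in>gball E x R. \<theta> y) < (\<Sum>y\<in>gball E x (L * R). \<theta> y)"
proof -
  \<comment> \<open>The 9 in place of 8 yields the strict inequality; the maximum with 1 keeps L R
    >= R0, where the volume bounds apply.\<close>
  define L where "L = max 1 ((9 * K * K' * C / c) powr (1 / d))"
  have L: "1 \<le> L"
    by (simp add: L_def)
  have "9 * K * K' * C / c = ((9 * K * K' * C / c) powr (1 / d)) powr d"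
    using d c C K by (simp add: powr_powr)
  also have "\<dots> \<le> L powr d"
    unfolding L_def using d by (intro powr_mono2) auto
  finally have Ld: "9 * K * K' * C \<le> c * L powr d"
    using c by (simp add: field_simps)
  have "8 * (\<Sum>y\<in>gball E x R. \<theta> y) < (\<Sum>y\<in>gball E x (L * R). \<theta> y)" if R: "R0 \<le> R" for R
  proof -
    let ?B = "gball E x (L * R)"
    have "1 * R \<le> L * R"
      using L R R0 by (intro mult_right_mono) auto
    then have LR: "R0 \<le> L * R" "1 \<le> R" "1 \<le> L * R"
      using R R0 by linarith+
    have card: "0 < real (card ?B)"
      using card_gball_pos[OF g, of "L * R" x] LR by simp
    have th: "0 \<le> (\<Sum>y\<in>?B. \<theta> y)"
      using theta by (simp add: sum_nonneg less_imp_le)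
    have "(real (card ?B))\<^sup>2 \<le> (\<Sum>y\<in>?B. \<theta> y) * (K' * real (card ?B))"
      using card_sq_le_sum_times_sum_inverse[of \<theta> ?B, OF theta] mult_left_mono[OF mean_inv[OF LR(3)] th]
      by (rule order_trans)
    then have "real (card ?B) * real (card ?B) \<le> K' * (\<Sum>y\<in>?B. \<theta> y) * real (card ?B)"
      by (simp only: power2_eq_square ac_simps)
    then have low: "real (card ?B) \<le> K' * (\<Sum>y\<in>?B. \<theta> y)"
      using card by (rule mult_right_le_imp_le)
    have "K * real (card (gball E x R)) \<le> K * (C * R powr d)"
      using vol(2)[OF R] K by (intro mult_left_mono) auto
    then have "(\<Sum>y\<in>gball E x R. \<theta> y) \<le> K * (C * R powr d)"
      by (rule order_trans[OF mean[OF LR(2)]])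
    then have "K' * (8 * (\<Sum>y\<in>gball E x R. \<theta> y)) \<le> K' * (8 * (K * (C * R powr d)))"
      using K by (intro mult_left_mono) auto
    also have "\<dots> < 9 * K * K' * C * R powr d"
      using K C LR(2) by simp
    also have "\<dots> \<le> c * L powr d * R powr d"
      using Ld by (intro mult_right_mono) auto
    also have "\<dots> = c * (L * R) powr d"
      using L LR(2) by (simp add: powr_mult)
    also have "\<dots> \<le> K' * (\<Sum>y\<in>?B. \<theta> y)"
      using vol(1)[OF LR(1)] low by (rule order_trans)
    finally show ?thesis
      using K by simp
  qed
  with L show ?thesis by blast
qed

text \<open>A Chebyshev bound: outside the ball \<open>eta\<close> is at least R, so there f^2 is at
  most \<open>eta\<close> to the m times f^2, divided by R^m. The set F is finite so that the result
  can be fed to the least-upper-bound property of s.\<close>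

lemma sum_sq_le_moment_split:
  fixes f \<theta> :: "'v \<Rightarrow> real"
  assumes g: "infinite_connected_lf_graph E"
    and theta: "\<And>y. 0 < \<theta> y"
    and m: "0 \<le> m" and R: "1 \<le> R"
    and h: "\<And>F. finite F \<Longrightarrow> (\<Sum>y\<in>F. eta E x y powr m * (f y)\<^sup>2 * \<theta> y) \<le> h"
    and F: "finite F"
  shows "(\<Sum>y\<in>F. (f y)\<^sup>2 * \<theta> y) \<le> (\<Sum>y\<in>gball E x R. (f y)\<^sup>2 * \<theta> y) + h / R powr m"
proof -
  let ?B = "gball E x R"
  have th: "0 \<le> \<theta> y" for y
    using theta[of y] by simp
  have Rm: "0 < R powr m"
    using R by simp
  have "(\<Sum>y\<in>F. (f y)\<^sup>2 * \<theta> y) = (\<Sum>y\<in>F \<inter> ?B. (f y)\<^sup>2 * \<theta> y) + (\<Sum>y\<in>F - ?B. (f y)\<^sup>2 * \<theta> y)"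
    using F by (rule sum.Int_Diff)
  moreover have "(\<Sum>y\<in>F \<inter> ?B. (f y)\<^sup>2 * \<theta> y) \<le> (\<Sum>y\<in>?B. (f y)\<^sup>2 * \<theta> y)"
    by (intro sum_mono2) (auto simp: finite_gball[OF g] th)
  moreover have "R powr m * (\<Sum>y\<in>F - ?B. (f y)\<^sup>2 * \<theta> y)
      \<le> (\<Sum>y\<in>F - ?B. eta E x y powr m * (f y)\<^sup>2 * \<theta> y)"
    unfolding sum_distrib_left
  proof (intro sum_mono)
    fix y assume "y \<in> F - ?B"
    then have "R \<le> eta E x y"
      by (auto simp: mem_gball eta_def)
    then have "R powr m \<le> eta E x y powr m"
      using R m by (intro powr_mono2) auto
    then show "R powr m * ((f y)\<^sup>2 * \<theta> y) \<le> eta E x y powr m * (f y)\<^sup>2 * \<theta> y"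
      unfolding mult.assoc using th by (intro mult_right_mono) auto
  qed
  then have "R powr m * (\<Sum>y\<in>F - ?B. (f y)\<^sup>2 * \<theta> y) \<le> h"
    using h[of "F - ?B"] F by simp
  then have "(\<Sum>y\<in>F - ?B. (f y)\<^sup>2 * \<theta> y) \<le> h / R powr m"
    using Rm by (simp add: field_simps)
  ultimately show ?thesis by linarith
qed

text \<open>Multiply and divide by W(u,v): its inverse is one summand of \<nu>(u), and e bounds the
  remaining factor.\<close>

lemma sq_increment_le_energy:
  fixes f :: "'v \<Rightarrow> real"
  assumes g: "infinite_connected_lf_graph E"
    and W_pos: "\<And>x y. adj E x y \<Longrightarrow> 0 < W x y"
    and e: "W u v * (f v - f u)\<^sup>2 \<le> e" and uv: "adj E u v"
  shows "(f v - f u)\<^sup>2 \<le> nu E W u * e"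
proof -
  have W: "0 < W u v"
    using W_pos uv .
  have "inverse (W u v) \<le> nu E W u"
    unfolding nu_def using finite_neighbours[OF g] uv W_pos
    by (intro member_le_sum) (auto simp: less_imp_le)
  moreover have "0 \<le> W u v * (f v - f u)\<^sup>2"
    using W by (intro mult_nonneg_nonneg) auto
  ultimately have "inverse (W u v) * (W u v * (f v - f u)\<^sup>2) \<le> nu E W u * e"
    using e W by (intro mult_mono) (auto intro: order_trans[of _ "inverse (W u v)"])
  then show ?thesis
    using W by (simp flip: mult.assoc)
qed

section \<open>The inequality between real numbers, with the choice of the radius\<close>

lemma nash_optimize:
  fixes s a h e :: real
  assumes s: "0 < s" and h: "0 < h" and m: "0 < m" and R0: "1 \<le> R0" and L: "1 \<le> L"
    and R: "R = R0 * (2 * h / s) powr (1 / m)"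
    and V: "0 < V" and e: "0 \<le> e"
    and main: "s \<le> 8 * (L * R) * sqrt (V * (L * R) powr d * e) * a"
  shows "s powr (2 + (d + 2) / m)
    \<le> 64 * V * (L * R0) powr (d + 2) * 2 powr ((d + 2) / m) * e * a\<^sup>2 * h powr ((d + 2) / m)"
proof -
  let ?k = "(d + 2) / m"
  have Rpos: "0 < R"
    using s h R0 R by simp
  define P where "P = (L * R) powr d"
  \<comment> \<open>Squaring produces (L R)^(d+2), which is (L R0)^(d+2) (2 h / s)^k with k =
    (d+2)/m by the form of R. Multiplying by s^k then removes s from the right-hand side.\<close>
  have "s\<^sup>2 \<le> (8 * (L * R) * sqrt (V * P * e) * a)\<^sup>2"
    using main s unfolding P_def by (intro power_mono) auto
  also have "\<dots> = 64 * (L * R)\<^sup>2 * (sqrt (V * P * e))\<^sup>2 * a\<^sup>2"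
    by (simp only: power_mult_distrib) simp
  also have "(sqrt (V * P * e))\<^sup>2 = V * P * e"
    using V e by (intro real_sqrt_pow2) (simp add: P_def)
  also have "64 * (L * R)\<^sup>2 * (V * P * e) * a\<^sup>2 = 64 * V * ((L * R)\<^sup>2 * P) * e * a\<^sup>2"
    by (simp only: mult.assoc mult.left_commute mult.commute)
  also have "(L * R)\<^sup>2 * P = (L * R) powr (d + 2)"
  proof -
    have "(L * R) powr (d + 2) = (L * R) powr d * (L * R) powr 2"
      by (rule powr_add)
    then show ?thesis
      using L Rpos by (simp add: P_def mult.commute)
  qed
  also have "(L * R) powr (d + 2) = (L * R0) powr (d + 2) * (2 * h / s) powr ?k"
  proof -
    have "L * R = L * R0 * (2 * h / s) powr (1 / m)"
      unfolding R by (rule mult.assoc[symmetric])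
    moreover have "(L * R0 * (2 * h / s) powr (1 / m)) powr (d + 2)
        = (L * R0) powr (d + 2) * ((2 * h / s) powr (1 / m)) powr (d + 2)"
      by (rule powr_mult)
    ultimately have "(L * R) powr (d + 2)
        = (L * R0) powr (d + 2) * ((2 * h / s) powr (1 / m)) powr (d + 2)"
      by (simp only:)
    then show ?thesis
      by (simp add: powr_powr)
  qed
  also have "(2 * h / s) powr ?k = 2 powr ?k * h powr ?k / s powr ?k"
    using s h by (simp add: powr_mult powr_divide)
  finally have le: "s\<^sup>2 \<le> 64 * V * ((L * R0) powr (d + 2) * (2 powr ?k * h powr ?k / s powr ?k)) * e * a\<^sup>2" .
  have "s powr (2 + ?k) = s\<^sup>2 * s powr ?k"
    using s by (simp add: powr_add)
  also have "\<dots> \<le> 64 * V * ((L * R0) powr (d + 2) * (2 powr ?k * h powr ?k / s powr ?k)) * e * a\<^sup>2 * s powr ?k"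
    using le by (rule mult_right_mono) simp
  also have "\<dots> = 64 * V * (L * R0) powr (d + 2) * 2 powr ?k * e * a\<^sup>2 * h powr ?k"
    using s by simp
  finally show ?thesis .
qed

text \<open>The constant A is obtained before f is given. The number s is described as the least
  upper bound of finite sums, a and h are just upper bounds, and e bounds each single term of the
  energy.\<close>

lemma nash_real:
  fixes \<theta> :: "'v \<Rightarrow> real"
  assumes g: "infinite_connected_lf_graph E"
    and theta: "\<And>y. 0 < \<theta> y"
    and W_pos: "\<And>x y. adj E x y \<Longrightarrow> 0 < W x y"
    and d: "0 < d" and m: "0 < m" and R0: "1 \<le> R0"
    and c: "0 < c" and C: "0 < C" and K: "0 < K" "0 < K'" "0 < K''"
    and vol: "\<And>R. R0 \<le> R \<Longrightarrow> c * R powr d \<le> real (card (gball E x R))"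
      "\<And>R. R0 \<le> R \<Longrightarrow> real (card (gball E x R)) \<le> C * R powr d"
    and mean: "\<And>R. 1 \<le> R \<Longrightarrow> (\<Sum>y\<in>gball E x R. \<theta> y) \<le> K * real (card (gball E x R))"
    and mean_inv:
      "\<And>R. 1 \<le> R \<Longrightarrow> (\<Sum>y\<in>gball E x R. inverse (\<theta> y)) \<le> K' * real (card (gball E x R))"
    and mean_nu: "\<And>R. 1 \<le> R \<Longrightarrow> (\<Sum>y\<in>gball E x R. nu E W y) \<le> K'' * real (card (gball E x R))"
  obtains A where "0 < A"
    and "\<And>f s a h e. \<lbrakk>0 < s; 0 \<le> e;
      \<And>F. finite F \<Longrightarrow> (\<Sum>y\<in>F. (f y)\<^sup>2 * \<theta> y) \<le> s;
      \<And>b. (\<And>F. finite F \<Longrightarrow> (\<Sum>y\<in>F. (f y)\<^sup>2 * \<theta> y) \<le> b) \<Longrightarrow> s \<le> b;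
      \<And>F. finite F \<Longrightarrow> (\<Sum>y\<in>F. \<bar>f y\<bar> * \<theta> y) \<le> a;
      \<And>F. finite F \<Longrightarrow> (\<Sum>y\<in>F. eta E x y powr m * (f y)\<^sup>2 * \<theta> y) \<le> h;
      \<And>u v. W u v * (f v - f u)\<^sup>2 \<le> e\<rbrakk>
      \<Longrightarrow> s powr (2 + (d + 2) / m) \<le> A * e * a\<^sup>2 * h powr ((d + 2) / m)"
proof -
  obtain L where L: "1 \<le> L"
    and grow: "\<And>R. R0 \<le> R \<Longrightarrow> 8 * (\<Sum>y\<in>gball E x R. \<theta> y) < (\<Sum>y\<in>gball E x (L * R). \<theta> y)"
    using weighted_volume_growth[of E \<theta> d R0 c C K K' x, OF g theta d R0 c C K(1,2) vol mean mean_inv]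
    by blast
  define V where "V = K'' * C"
  have V: "0 < V"
    using K C by (simp add: V_def)
  have main: "s powr (2 + (d + 2) / m) \<le>
      64 * V * (L * R0) powr (d + 2) * 2 powr ((d + 2) / m) * e * a\<^sup>2 * h powr ((d + 2) / m)"
    if s: "0 < s" and e: "0 \<le> e"
      and upper: "\<And>F. finite F \<Longrightarrow> (\<Sum>y\<in>F. (f y)\<^sup>2 * \<theta> y) \<le> s"
      and least: "\<And>b. (\<And>F. finite F \<Longrightarrow> (\<Sum>y\<in>F. (f y)\<^sup>2 * \<theta> y) \<le> b) \<Longrightarrow> s \<le> b"
      and a: "\<And>F. finite F \<Longrightarrow> (\<Sum>y\<in>F. \<bar>f y\<bar> * \<theta> y) \<le> a"
      and h: "\<And>F. finite F \<Longrightarrow> (\<Sum>y\<in>F. eta E x y powr m * (f y)\<^sup>2 * \<theta> y) \<le> h"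
      and energy: "\<And>u v. W u v * (f v - f u)\<^sup>2 \<le> e"
    for f :: "'v \<Rightarrow> real" and s a h e
  proof -
    \<comment> \<open>Holds because \<open>eta\<close> >= 1. It gives 2 h / s >= 1 and so places the
      radius chosen below at or above R0.\<close>
    have "s \<le> h"
    proof (rule least)
      fix F :: "'v set" assume F: "finite F"
      have "(\<Sum>y\<in>F. (f y)\<^sup>2 * \<theta> y) \<le> (\<Sum>y\<in>F. eta E x y powr m * (f y)\<^sup>2 * \<theta> y)"
      proof (intro sum_mono)
        fix y
        have "1 \<le> eta E x y powr m"
          using m by (intro ge_one_powr_ge_zero) (auto simp: eta_def)
        then have "1 * ((f y)\<^sup>2 * \<theta> y) \<le> eta E x y powr m * ((f y)\<^sup>2 * \<theta> y)"
          using theta[of y] by (intro mult_right_mono) auto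
        then show "(f y)\<^sup>2 * \<theta> y \<le> eta E x y powr m * (f y)\<^sup>2 * \<theta> y"
          by simp
      qed
      then show "(\<Sum>y\<in>F. (f y)\<^sup>2 * \<theta> y) \<le> h"
        using h[OF F] by simp
    qed
    then have hpos: "0 < h" and ratio: "1 \<le> 2 * h / s"
      using s by auto
    \<comment> \<open>With this choice R^m >= 2 h / s, so the tail h / R^m is at most s/2 and the
      ball carries at least half of s.\<close>
    define R where "R = R0 * (2 * h / s) powr (1 / m)"
    have "1 \<le> (2 * h / s) powr (1 / m)"
      using ratio m by (intro ge_one_powr_ge_zero) auto
    then have R: "R0 \<le> R"
      using R0 by (simp add: R_def)
    then have R1: "1 \<le> R"
      using R0 by simp
    have "1 * R \<le> L * R"
      using L R1 by (intro mult_right_mono) auto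
    then have RL: "R0 \<le> L * R" "1 \<le> L * R"
      using R R1 by linarith+
    have "1 * (2 * h / s) \<le> R0 powr m * (2 * h / s)"
      using R0 m ratio by (intro mult_right_mono ge_one_powr_ge_zero) auto
    also have "\<dots> = R powr m"
      using R0 m hpos s by (simp add: R_def powr_mult powr_powr)
    finally have "h / R powr m \<le> s / 2"
      using s hpos R1 by (simp add: field_simps)
    moreover have "s \<le> (\<Sum>y\<in>gball E x R. (f y)\<^sup>2 * \<theta> y) + h / R powr m"
      by (rule least) (rule sum_sq_le_moment_split[OF g theta less_imp_le[OF m] R1 h])
    ultimately have half: "s \<le> 2 * (\<Sum>y\<in>gball E x R. (f y)\<^sup>2 * \<theta> y)"
      by linarith
    \<comment> \<open>Only u has to lie in B(L R): \<nu>(u) is at most the sum of \<nu> over that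
      ball, which is at most V (L R)^d. The endpoint v may lie outside.\<close>
    have "\<bar>f v - f u\<bar> \<le> sqrt (V * (L * R) powr d * e)"
      if uv: "adj E u v" and u: "real (gdist E x u) \<le> L * R" for u v
    proof -
      let ?B = "gball E x (L * R)"
      have nu0: "0 \<le> nu E W y" for y
        unfolding nu_def using W_pos by (intro sum_nonneg) (simp add: less_imp_le)
      have "nu E W u \<le> (\<Sum>y\<in>?B. nu E W y)"
        using u by (intro member_le_sum) (auto simp: mem_gball finite_gball[OF g] nu0)
      also have "\<dots> \<le> K'' * real (card ?B)"
        by (rule mean_nu[OF RL(2)])
      also have "\<dots> \<le> K'' * (C * (L * R) powr d)"
        using vol(2)[OF RL(1)] K by (intro mult_left_mono) auto
      finally have "nu E W u * e \<le> V * (L * R) powr d * e"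
        using e by (intro mult_right_mono) (simp_all add: V_def)
      with sq_increment_le_energy[of E W u v f e, OF g W_pos energy uv] have "(f v - f u)\<^sup>2 \<le> V * (L * R) powr d * e"
        by linarith
      then have "sqrt ((f v - f u)\<^sup>2) \<le> sqrt (V * (L * R) powr d * e)"
        by (rule real_sqrt_le_mono)
      then show ?thesis
        by (simp only: real_sqrt_abs)
    qed
    note increment = this
    have "0 \<le> sqrt (V * (L * R) powr d * e)"
      using V e by simp
    from sum_sq_le_increment[where f = f, OF g theta R1 L grow[OF R] half
        upper[OF finite_gball[OF g]] a[OF finite_gball[OF g]] increment this]
    have "s \<le> 8 * (L * R) * sqrt (V * (L * R) powr d * e) * a" .
    then show ?thesis
      by (rule nash_optimize[OF s hpos m R0 L R_def V e])
  qed
  show thesis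
  proof (rule that[of "64 * V * (L * R0) powr (d + 2) * 2 powr ((d + 2) / m)"], goal_cases)
    case 1
    show ?case using V L R0 by simp
  next
    case (2 f s a h e)
    show ?case
      by (rule main[where f = f and s = s and a = a and h = h and e = e, OF 2])
  qed
qed

section \<open>From real numbers to [0,\<infinity>]\<close>

lemma nash_exponents:
  fixes s A t a h k :: real
  assumes s: "0 < s" and A: "0 < A" and t: "0 \<le> t" and a: "0 \<le> a" and h: "0 \<le> h" and k: "0 < k"
    and le: "s powr (2 + k) \<le> A * t * a\<^sup>2 * h powr k"
  shows "s \<le> (2 * A) powr (1 / (2 + k)) * (t / 2) powr (1 / (2 + k)) * a powr (2 * (1 / (2 + k)))
    * (h powr (1 / 2)) powr (2 * (k / (2 + k)))"
proof -
  let ?b = "1 / (2 + k)"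
  have "s = (s powr (2 + k)) powr ?b"
    using s k by (simp add: powr_powr)
  also have "\<dots> \<le> (A * t * a\<^sup>2 * h powr k) powr ?b"
    using le k by (intro powr_mono2) auto
  \<comment> \<open>Here t is the sum over ordered pairs, so t / 2 is the energy and 2 A
    compensates. Below, h becomes the square of its root because the weighted norm is that
    root.\<close>
  also have "A * t * a\<^sup>2 * h powr k = (2 * A) * (t / 2) * a powr 2 * h powr k"
    using a by simp
  also have "\<dots> powr ?b = (2 * A) powr ?b * (t / 2) powr ?b * (a powr 2) powr ?b * (h powr k) powr ?b"
    by (simp only: powr_mult)
  also have "(a powr 2) powr ?b = a powr (2 * ?b)"
    by (rule powr_powr)
  also have "(h powr k) powr ?b = (h powr (1 / 2)) powr (2 * (k / (2 + k)))"
    by (simp add: powr_powr)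
  finally show ?thesis .
qed

lemma epowr_half_square: "(S epowr (1 / 2))\<^sup>2 = S"
  by (cases S) (simp_all add: epowr_def powr_half_sqrt ennreal_power power2_eq_square ennreal_mult_top
      flip: ennreal_mult)

lemma times_top_infinite [simp]: "x \<odot> top = top" "top \<odot> x = top"
  by (simp_all add: times_top_def)

lemma times_top_ennreal: "0 \<le> x \<Longrightarrow> 0 \<le> y \<Longrightarrow> ennreal x \<odot> ennreal y = ennreal (x * y)"
  by (simp add: times_top_def ennreal_mult)

lemma epowr_infinite [simp]: "top epowr a = top"
  by (simp add: epowr_def)

text \<open>The claim covers all constants C' >= C, so that a factor at least 1, such as a power of
  R1, can be absorbed later.\<close>

lemma anchored_nash_of_volume_growth:
  fixes E :: "'v set set" and orig :: 'v
    and \<theta> :: "'v \<Rightarrow> real" and W :: "'v \<Rightarrow> 'v \<Rightarrow> real"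
    and d R0 \<alpha>0 m :: real and p q :: ennreal
  assumes g: "infinite_connected_lf_graph E"
    and theta: "\<And>y. 0 < \<theta> y"
    and W_nonneg: "\<And>x y. 0 \<le> W x y"
    and W_pos: "\<And>x y. adj E x y \<Longrightarrow> 0 < W x y"
    and d: "0 < d" and m: "0 < m" and R0: "1 \<le> R0" and \<alpha>0: "\<alpha>0 \<le> 1"
    and vol: "volume_regular E orig d R0 \<alpha>0"
    and pq: "1 \<le> p" "1 \<le> q"
    and theta_bd: "(SUP R\<in>{1::real..}. ennreal (norm_avg p (gball E orig R) \<theta>)) < \<infinity>"
    and theta_inv_bd:
      "(SUP R\<in>{1::real..}. ennreal (norm_avg 1 (gball E orig R) (\<lambda>y. inverse (\<theta> y)))) < \<infinity>"
    and nu_bd: "(SUP R\<in>{1::real..}. ennreal (norm_avg q (gball E orig R) (nu E W))) < \<infinity>"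
  shows "\<exists>C>0. \<exists>\<alpha> \<beta> \<gamma>. \<alpha> \<in> {0<..<1} \<and> \<beta> \<in> {0<..<1} \<and> \<gamma> \<in> {0<..<1} \<and> \<alpha> + \<beta> + \<gamma> = 1 \<and>
    (\<forall>C'\<ge>C. \<forall>f. anchored_nash E orig \<theta> W p q m C' \<alpha> \<beta> \<gamma> f)"
proof -
  obtain c C where c: "0 < c" and C: "0 < C"
    and vol': "\<forall>R\<ge>R0. \<forall>r. R powr \<alpha>0 \<le> r \<and> r \<le> R \<longrightarrow> (\<forall>x\<in>gball E orig R.
      c * r powr d \<le> real (card (gball E x r)) \<and> real (card (gball E x r)) \<le> C * r powr d)"
    using vol unfolding volume_regular_def by blast
  \<comment> \<open>The volume hypothesis is used at the anchor with r = R, which is admissible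
    since R^\<alpha>0 <= R.\<close>
  have ball: "c * R powr d \<le> real (card (gball E orig R)) \<and> real (card (gball E orig R)) \<le> C * R powr d"
    if R: "R0 \<le> R" for R
  proof -
    have "R powr \<alpha>0 \<le> R powr 1"
      using R R0 \<alpha>0 by (intro powr_mono) auto
    then have "R powr \<alpha>0 \<le> R"
      using R R0 by simp
    moreover have "orig \<in> gball E orig R"
      using R R0 by (simp add: center_in_gball)
    ultimately show ?thesis
      using vol' R by blast
  qed
  obtain K where K: "0 < K" "\<And>R. 1 \<le> R \<Longrightarrow> (\<Sum>y\<in>gball E orig R. \<theta> y) \<le> K * real (card (gball E orig R))"
    using sum_le_card_of_norm_avg_bounded[OF g pq(1) theta_bd] by blast
  obtain K' where K': "0 < K'"
    "\<And>R. 1 \<le> R \<Longrightarrow> (\<Sum>y\<in>gball E orig R. inverse (\<theta> y)) \<le> K' * real (card (gball E orig R))"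
    using sum_le_card_of_norm_avg_bounded[OF g order_refl theta_inv_bd] by blast
  obtain K'' where K'': "0 < K''"
    "\<And>R. 1 \<le> R \<Longrightarrow> (\<Sum>y\<in>gball E orig R. nu E W y) \<le> K'' * real (card (gball E orig R))"
    using sum_le_card_of_norm_avg_bounded[OF g pq(2) nu_bd] by blast
  define k where "k = (d + 2) / m"
  obtain A where A: "0 < A"
    and nash: "\<And>f s a h e. \<lbrakk>0 < s; 0 \<le> e;
      \<And>F. finite F \<Longrightarrow> (\<Sum>y\<in>F. (f y)\<^sup>2 * \<theta> y) \<le> s;
      \<And>b. (\<And>F. finite F \<Longrightarrow> (\<Sum>y\<in>F. (f y)\<^sup>2 * \<theta> y) \<le> b) \<Longrightarrow> s \<le> b;
      \<And>F. finite F \<Longrightarrow> (\<Sum>y\<in>F. \<bar>f y\<bar> * \<theta> y) \<le> a;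
      \<And>F. finite F \<Longrightarrow> (\<Sum>y\<in>F. eta E orig y powr m * (f y)\<^sup>2 * \<theta> y) \<le> h;
      \<And>u v. W u v * (f v - f u)\<^sup>2 \<le> e\<rbrakk>
      \<Longrightarrow> s powr (2 + k) \<le> A * e * a\<^sup>2 * h powr k"
    unfolding k_def
    by (rule nash_real[of E \<theta> W d m R0 c C K K' K'' orig,
          OF g theta W_pos d m R0 c C K(1) K'(1) K''(1) _ _ K(2) K'(2) K''(2)])
      (use ball in blast)+
  have k: "0 < k"
    using d m by (simp add: k_def)
  \<comment> \<open>The exponents come from taking the root of order 2 + k of e a^2 h^k; the energy
    and the L1 norm share the value \<alpha>.\<close>
  define \<alpha> where "\<alpha> = 1 / (2 + k)"
  define \<gamma> where "\<gamma> = k / (2 + k)"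
  have "anchored_nash E orig \<theta> W p q m C' \<alpha> \<alpha> \<gamma> f" if C': "(2 * A) powr \<alpha> \<le> C'" for C' f
  proof -
    define S where "S = (\<Sum>\<^sub>\<infinity>y. ennreal ((f y)\<^sup>2 * \<theta> y))"
    define N where "N = (\<Sum>\<^sub>\<infinity>y. ennreal (\<bar>f y\<bar> * \<theta> y))"
    define H where "H = (\<Sum>\<^sub>\<infinity>y. ennreal (eta E orig y powr m * (f y)\<^sup>2 * \<theta> y))"
    define T where "T = (\<Sum>\<^sub>\<infinity>z. ennreal (W (fst z) (snd z) * (f (snd z) - f (fst z))\<^sup>2))"
    have th: "0 \<le> \<theta> y" for y
      using theta[of y] by simp
    have S: "(norm_weighted 2 \<theta> f)\<^sup>2 = S"
      unfolding norm_weighted_def S_def epowr_half_square by simp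
    have N: "norm_weighted 1 \<theta> f = N"
      by (cases N) (simp_all add: norm_weighted_def epowr_def flip: N_def)
    have "(eta E orig y powr (m / 2))\<^sup>2 = eta E orig y powr m" for y
      by (simp add: power2_eq_square flip: powr_add)
    then have "\<bar>eta E orig y powr (m / 2) * f y\<bar> powr 2 = eta E orig y powr m * (f y)\<^sup>2" for y
      by (simp add: power_mult_distrib)
    then have H: "norm_weighted 2 \<theta> (\<lambda>y. eta E orig y powr (m / 2) * f y) = H epowr (1 / 2)"
      unfolding norm_weighted_def H_def by simp
    have T: "energy W f = (1 / 2) * T"
      unfolding energy_def T_def case_prod_unfold ..
    let ?M = "moment_const E orig \<theta> W p q"
    let ?rhs = "ennreal C' \<odot> ?M \<odot> ((1 / 2) * T) epowr \<alpha> \<odot> N epowr (2 * \<alpha>) \<odot> (H epowr (1 / 2)) epowr (2 * \<gamma>)"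
    have "S \<le> ?rhs"
    \<comment> \<open>If some factor is infinite, so is the right-hand side, even when another
      factor vanishes: this is the convention built into \<open>\<odot>\<close>. In the remaining
      case everything is a real number and s > 0.\<close>
    proof (cases "S = 0 \<or> ?M = \<infinity> \<or> T = \<infinity> \<or> N = \<infinity> \<or> H = \<infinity>")
      case True
      then show ?thesis
        by (auto simp: ennreal_mult_top)
    next
      case False
      then obtain M t a h where fin: "?M = ennreal M" "0 \<le> M" "T = ennreal t" "0 \<le> t"
        "N = ennreal a" "0 \<le> a" "H = ennreal h" "0 \<le> h"
        by (metis ennreal_cases infinity_ennreal_def)
      have M: "1 \<le> M"
        using moment_const_ge_1[OF g, of orig \<theta> W p q] fin(1,2) by simp
      have hF: "(\<Sum>y\<in>F. eta E orig y powr m * (f y)\<^sup>2 * \<theta> y) \<le> h" if "finite F" for F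
        using that fin(7,8) th by (intro sum_le_of_infsum_ennreal) (auto simp: H_def)
      have aF: "(\<Sum>y\<in>F. \<bar>f y\<bar> * \<theta> y) \<le> a" if "finite F" for F
        using that fin(5,6) th by (intro sum_le_of_infsum_ennreal) (auto simp: N_def)
      have tF: "W u v * (f v - f u)\<^sup>2 \<le> t" for u v
        using sum_le_of_infsum_ennreal[of "\<lambda>z. W (fst z) (snd z) * (f (snd z) - f (fst z))\<^sup>2" t "{(u, v)}"]
          fin(3,4) W_nonneg by (simp add: T_def)
      \<comment> \<open>Since \<open>eta\<close> >= 1, finiteness of S follows from that of
        H.\<close>
      have "S \<le> H"
        unfolding S_def H_def
      proof (intro infsum_mono nonneg_summable_on_complete ennreal_leI)
        fix y
        have "1 * ((f y)\<^sup>2 * \<theta> y) \<le> eta E orig y powr m * ((f y)\<^sup>2 * \<theta> y)"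
          using th m by (intro mult_right_mono ge_one_powr_ge_zero) (auto simp: eta_def)
        then show "(f y)\<^sup>2 * \<theta> y \<le> eta E orig y powr m * (f y)\<^sup>2 * \<theta> y"
          by (simp add: mult.assoc)
      qed auto
      then have "S \<noteq> top"
        using fin(7) by (auto simp: top_unique)
      then obtain s where s: "S = ennreal s" "0 \<le> s"
        by (cases S) auto
      have "0 < s"
        using False s by (cases "s = 0") auto
      have sF: "(\<Sum>y\<in>F. (f y)\<^sup>2 * \<theta> y) \<le> s" if "finite F" for F
        using that s th by (intro sum_le_of_infsum_ennreal) (auto simp: S_def)
      have sL: "s \<le> b" if "\<And>F. finite F \<Longrightarrow> (\<Sum>y\<in>F. (f y)\<^sup>2 * \<theta> y) \<le> b" for b
      proof -
        \<comment> \<open>The empty set gives the sign of b, needed to compare reals through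
          \<open>ennreal\<close>.\<close>
        have "0 \<le> b"
          using that[of "{}"] by simp
        moreover have "ennreal s \<le> ennreal b"
          unfolding s(1)[symmetric] S_def using th that by (intro infsum_ennreal_le) auto
        ultimately show ?thesis by simp
      qed
      have "s powr (2 + k) \<le> A * t * a\<^sup>2 * h powr k"
        by (rule nash[where f = f and s = s and a = a and h = h and e = t, OF \<open>0 < s\<close> fin(4) sF sL aF hF tF])
      from nash_exponents[OF \<open>0 < s\<close> A fin(4,6,8) k this]
      have "s \<le> (2 * A) powr \<alpha> * ((t / 2) powr \<alpha> * a powr (2 * \<alpha>) * (h powr (1 / 2)) powr (2 * \<gamma>))"
        by (simp add: \<alpha>_def \<gamma>_def mult.assoc)
      \<comment> \<open>The moment constant M >= 1 enters here, together with the enlargement of the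
        constant to C'.\<close>
      also have "\<dots> \<le> (C' * M) * ((t / 2) powr \<alpha> * a powr (2 * \<alpha>) * (h powr (1 / 2)) powr (2 * \<gamma>))"
      proof (intro mult_right_mono)
        have C'0: "0 \<le> C'"
          by (rule order_trans[OF _ C']) simp
        show "(2 * A) powr \<alpha> \<le> C' * M"
          using C' mult_left_mono[OF M C'0] by simp
      qed auto
      finally have "ennreal s \<le> ennreal (C' * M * (t / 2) powr \<alpha> * a powr (2 * \<alpha>) * (h powr (1 / 2)) powr (2 * \<gamma>))"
        by (intro ennreal_leI) (simp add: mult.assoc)
      moreover have "(1 / 2) * T = ennreal (t / 2)"
        using fin(4) by (simp add: fin(3) ennreal_divide_times divide_ennreal[symmetric])
      moreover have "0 \<le> C'"
        by (rule order_trans[OF _ C']) simp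
      ultimately show ?thesis
        using fin(2,4,6,8) by (simp add: s(1) fin(1,5,7) epowr_ennreal times_top_ennreal)
    qed
    then show ?thesis
      unfolding anchored_nash_def S N H T .
  qed
  moreover have "\<alpha> \<in> {0<..<1}" "\<gamma> \<in> {0<..<1}"
    using k by (auto simp: \<alpha>_def \<gamma>_def field_simps)
  moreover have "\<alpha> + \<alpha> + \<gamma> = 1"
    using k by (simp add: \<alpha>_def \<gamma>_def flip: add_divide_distrib)
  moreover have "0 < (2 * A) powr \<alpha>"
    using A by simp
  ultimately show ?thesis
    by blast
qed

section \<open>Both statements from the growth lemma, with d' = d + 1 in the first\<close>

theorem theorem1p4:
  fixes E :: "'v set set" and orig :: 'v
    and \<theta> :: "'v \<Rightarrow> real" and W :: "'v \<Rightarrow> 'v \<Rightarrow> real"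
    and d R0 \<alpha>0 :: real and R1 :: "real \<Rightarrow> real" and p q :: ennreal
  assumes graph: "infinite_connected_lf_graph E"
    and theta_pos: "\<And>y. 0 < \<theta> y"
    and W_nonneg: "\<And>x y. 0 \<le> W x y"
    and W_sym: "\<And>x y. W x y = W y x"
    and W_pos: "\<And>x y. adj E x y \<Longrightarrow> 0 < W x y"
    and W_summable: "\<And>x. (\<lambda>y. W x y) summable_on UNIV"
    and d: "2 \<le> d" and R0: "1 \<le> R0" and \<alpha>0: "0 \<le> \<alpha>0" "\<alpha>0 < 1 / 2"
    and regular: "large_scale_regular E orig d R0 \<alpha>0 R1"
    and pq: "1 < p" "1 < q" "1 / p + 1 / q < ennreal (2 / d)"
    and moments:
      "(SUP R\<in>{1::real..}. ennreal (norm_avg p (gball E orig R) \<theta>)) +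
       (SUP R\<in>{1::real..}. ennreal (norm_avg 1 (gball E orig R) (\<lambda>y. inverse (\<theta> y)))) +
       (SUP R\<in>{1::real..}. ennreal (norm_avg q (gball E orig R) (nu E W))) < \<infinity>"
  shows "((INF y. \<theta> y) > 0 \<longrightarrow>
           (\<forall>m \<ge> 2. \<exists>d' > d. \<exists>C2 > 0. \<exists>\<alpha> \<beta> \<gamma>.
              \<alpha> \<in> {0<..<1} \<and> \<beta> \<in> {0<..<1} \<and> \<gamma> \<in> {0<..<1} \<and> \<alpha> + \<beta> + \<gamma> = 1 \<and>
              (\<forall>f. anchored_nash E orig \<theta> W p q m (C2 * R1 d' powr m) \<alpha> \<beta> \<gamma> f))) \<and>
         (all_scale_regular E orig d \<longrightarrow>
           (\<forall>m \<ge> 2. \<exists>C2 > 0. \<exists>\<alpha> \<beta> \<gamma>.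
              \<alpha> \<in> {0<..<1} \<and> \<beta> \<in> {0<..<1} \<and> \<gamma> \<in> {0<..<1} \<and> \<alpha> + \<beta> + \<gamma> = 1 \<and>
              (\<forall>f. anchored_nash E orig \<theta> W p q m C2 \<alpha> \<beta> \<gamma> f)))"
proof (intro conjI impI allI)
  have "(SUP R\<in>{1::real..}. ennreal (norm_avg p (gball E orig R) \<theta>)) < \<infinity>"
    "(SUP R\<in>{1::real..}. ennreal (norm_avg 1 (gball E orig R) (\<lambda>y. inverse (\<theta> y)))) < \<infinity>"
    "(SUP R\<in>{1::real..}. ennreal (norm_avg q (gball E orig R) (nu E W))) < \<infinity>"
    using moments by (simp_all only: infinity_ennreal_def ennreal_add_less_top)
  note nash = anchored_nash_of_volume_growth[where W = W, OF graph theta_pos W_nonneg W_pos _ _ R0 _ _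
      less_imp_le[OF pq(1)] less_imp_le[OF pq(2)] this]
  have vol: "volume_regular E orig d R0 \<alpha>0"
    using regular by (simp add: large_scale_regular_def)
  {
    fix m :: real
    assume "2 \<le> m"
    then have "\<exists>C>0. \<exists>\<alpha> \<beta> \<gamma>. \<alpha> \<in> {0<..<1} \<and> \<beta> \<in> {0<..<1} \<and> \<gamma> \<in> {0<..<1} \<and> \<alpha> + \<beta> + \<gamma> = 1 \<and>
        (\<forall>C'\<ge>C. \<forall>f. anchored_nash E orig \<theta> W p q m C' \<alpha> \<beta> \<gamma> f)"
      using d \<alpha>0 by (intro nash[OF _ _ _ _ vol]) auto
  }
  note core = this
  fix m :: real
  assume m: "2 \<le> m"
  from core[OF m] obtain C \<alpha> \<beta> \<gamma> where C: "0 < C"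
    and exps: "\<alpha> \<in> {0<..<1} \<and> \<beta> \<in> {0<..<1} \<and> \<gamma> \<in> {0<..<1} \<and> \<alpha> + \<beta> + \<gamma> = 1"
    and main: "\<And>C' f. C \<le> C' \<Longrightarrow> anchored_nash E orig \<theta> W p q m C' \<alpha> \<beta> \<gamma> f"
    by blast
  show "\<exists>C2>0. \<exists>\<alpha> \<beta> \<gamma>. \<alpha> \<in> {0<..<1} \<and> \<beta> \<in> {0<..<1} \<and> \<gamma> \<in> {0<..<1} \<and> \<alpha> + \<beta> + \<gamma> = 1 \<and>
      (\<forall>f. anchored_nash E orig \<theta> W p q m C2 \<alpha> \<beta> \<gamma> f)"
    using C exps main[OF order_refl] by blast
  \<comment> \<open>The witness is d' = d + 1. As R1 (d + 1) >= R0 >= 1, the prefactor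
    \<open>R1 (d + 1) powr m\<close> only enlarges C.\<close>
  have "1 \<le> R1 (d + 1)"
    using regular R0 unfolding large_scale_regular_def by (meson less_add_one order_trans)
  then have "1 \<le> R1 (d + 1) powr m"
    using m by (intro ge_one_powr_ge_zero) auto
  then have "C \<le> C * R1 (d + 1) powr m"
    using C by simp
  then have "\<forall>f. anchored_nash E orig \<theta> W p q m (C * R1 (d + 1) powr m) \<alpha> \<beta> \<gamma> f"
    using main by blast
  then show "\<exists>d'>d. \<exists>C2>0. \<exists>\<alpha> \<beta> \<gamma>. \<alpha> \<in> {0<..<1} \<and> \<beta> \<in> {0<..<1} \<and> \<gamma> \<in> {0<..<1} \<and>
      \<alpha> + \<beta> + \<gamma> = 1 \<and> (\<forall>f. anchored_nash E orig \<theta> W p q m (C2 * R1 d' powr m) \<alpha> \<beta> \<gamma> f)"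
    using C exps less_add_one by blast
qed

end
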